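(* Consider an agent $i$ and an iteration $k\ge 0$ of AdGT with $\|\bm x_i^{k+1}-\bm x_i^k\|>0$, and define $$\bm g_i^k=\nabla f_i(\bm x_i^{k+1})-\nabla f_i(\bm x_i^k),\qquad \bm r_i^k=\sum_j w_{ij}(\bm y_j^k-\bm y_i^k).$$ Then $\bm y_i^{k+1}-\bm y_i^k=\bm g_i^k+\bm r_i^k$, $$(L_{y_i}^k)^2-(L_{f_i}^k)^2=\frac{2\langle\bm g_i^k,\bm r_i^k\rangle+\|\bm r_i^k\|^2}{\|\bm x_i^{k+1}-\bm x_i^k\|^2},$$ and therefore $$\frac{1}{2\gamma L_{y_i}^k}\le\frac{1}{2\gamma L_{f_i}^k}\iff 2\langle\bm g_i^k,\bm r_i^k\rangle+\|\bm r_i^k\|^2\ge0 .$$ (A) For the combined update $\alpha_i^{k+1}=\min\{\frac{1}{2\gamma L_{f_i}^k},\frac{1}{2\gamma L_{y_i}^k},\sqrt{1+\theta_i^k}\,\alpha_i^k\}$: the tracking-based candidate $\frac{1}{2\gamma L_{y_i}^k}$ attains the minimum (possibly with a tie) when $$2\langle\bm g_i^k,\bm r_i^k\rangle+\|\bm r_i^k\|^2\ge0\quad\text{and}\quad \frac{1}{2\gamma L_{y_i}^k}\le\sqrt{1+\theta_i^k}\,\alpha_i^k,$$ and when both inequalities are strict it is the unique minimizing candidate. When evaluated at the same state with the same $\alpha_i^k,\theta_i^k,\gamma$, this update cannot produce a larger next stepsize than the update $\alpha_i^{k+1}=\min\{\frac{1}{2\gamma L_{f_i}^k},\sqrt{1+\theta_i^k}\,\alpha_i^k\}$.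 Moreover, $$2\gamma\,\alpha_i^{k+1}\,\|\bm y_i^{k+1}-\bm y_i^k\|\le\|\bm x_i^{k+1}-\bm x_i^k\| .$$ (B) For the tracking update $\alpha_i^{k+1}=\min\{\frac{1}{2\gamma L_{y_i}^k},\sqrt{1+\theta_i^k}\,\alpha_i^k\}$: the tracking-based candidate attains the minimum (possibly with a tie) when $\frac{1}{2\gamma L_{y_i}^k}\le\sqrt{1+\theta_i^k}\,\alpha_i^k$, and the bound $2\gamma\,\alpha_i^{k+1}\|\bm y_i^{k+1}-\bm y_i^k\|\le\|\bm x_i^{k+1}-\bm x_i^k\|$ also holds.
   Context: Problem. Let $\mathcal G=(\mathcal V,\mathcal E)$, $\mathcal V=\{1,\dots,n\}$, be an undirected connected graph, and let $\mathcal N_i=\{j:(j,i)\in\mathcal E\}\cup\{i\}$. $W=[w_{ij}]\in\mathbb R^{n\times n}$ is a symmetric doubly stochastic matrix with $w_{ij}>0$ if $j\in\mathcal N_i$ and $w_{ij}=0$ otherwise. Standing assumptions: each agent $i$ has a function $f_i:\mathbb R^p\to\mathbb R$ that is differentiable with $L_i$-Lipschitz gradient and $\mu_i$-strongly convex, i.e. $f_i(\bm y)\ge f_i(\bm x)+\nabla f_i(\bm x)^\top(\bm y-\bm x)+\frac{\mu_i}{2}\|\bm y-\bm x\|^2$ for all $\bm x,\bm y$, with $\mu_i>0$. $\|\cdot\|$ is the Euclidean norm and $\langle\cdot,\cdot\rangle$ the Euclidean inner product. Algorithm AdGT. Given $\gamma>0$ (a common safety factor), $\bm x_i^0\in\mathbb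 R^p$, $\bm y_i^0=\nabla f_i(\bm x_i^0)$, $\alpha_i^0>0$, $\theta_i^0=0$, for $k=0,1,\dots$ every agent $i$ computes $$\bm x_i^{k+1}=\sum_{j\in\mathcal N_i}w_{ij}(\bm x_j^k-\alpha_j^k\bm y_j^k),\qquad \bm y_i^{k+1}=\sum_{j\in\mathcal N_i}w_{ij}\bm y_j^k+\nabla f_i(\bm x_i^{k+1})-\nabla f_i(\bm x_i^k),$$ then $\alpha_i^{k+1}$ by the stated stepsize update, and $\theta_i^{k+1}=\alpha_i^{k+1}/\alpha_i^k$. Here $$L_{f_i}^k=\frac{\|\nabla f_i(\bm x_i^{k+1})-\nabla f_i(\bm x_i^k)\|}{\|\bm x_i^{k+1}-\bm x_i^k\|},\qquad L_{y_i}^k=\frac{\|\bm y_i^{k+1}-\bm y_i^k\|}{\|\bm x_i^{k+1}-\bm x_i^k\|}.$$ Conventions: if $\bm x_i^{k+1}=\bm x_i^k$ for some $k\ge1$, set $\alpha_i^{k+1}=\alpha_i^k$; quantities needed at $k=0$ are assumed well defined; if the denominator is nonzero but $L_{f_i}^k=0$ or $L_{y_i}^k=0$, the corresponding candidate is interpreted as $+\infty$ and omitted from the minimum. *)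

theory Defs
  imports "HOL-Analysis.Analysis"
begin

definition gradient :: "('a::real_inner \<Rightarrow> real) \<Rightarrow> 'a \<Rightarrow> 'a" where
  "gradient f x = (THE D. GDERIV f x :> D)"

lemma GDERIV_gradient:
  fixes f :: "'a::euclidean_space \<Rightarrow> real"
  assumes "f differentiable (at x)"
  shows "GDERIV f x :> gradient f x"
proof -
  obtain f' where f': "(f has_derivative f') (at x)"
    using assms by (auto simp: differentiable_def)
  then interpret linear f' by (rule has_derivative_linear)
  have "f' h = h \<bullet> (\<Sum>b\<in>Basis. f' b *\<^sub>R b)" for h
  proof -
    have "f' h = f' (\<Sum>b\<in>Basis. (h \<bullet> b) *\<^sub>R b)"
      by (simp only: euclidean_representation)
    also have "\<dots> = (\<Sum>b\<in>Basis. (h \<bullet> b) * f' b)"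
      by (simp only: sum scale real_scaleR_def)
    also have "\<dots> = h \<bullet> (\<Sum>b\<in>Basis. f' b *\<^sub>R b)"
      by (simp only: inner_sum_right inner_scaleR_right mult.commute)
    finally show ?thesis .
  qed
  hence "f' = (\<lambda>h. h \<bullet> (\<Sum>b\<in>Basis. f' b *\<^sub>R b))"
    by (rule ext)
  with f' have ex: "GDERIV f x :> (\<Sum>b\<in>Basis. f' b *\<^sub>R b)"
    unfolding gderiv_def by (rule back_subst)
  have uniq: "D = D'" if "GDERIV f x :> D" "GDERIV f x :> D'" for D D'
  proof -
    have "(\<lambda>h. h \<bullet> D) = (\<lambda>h. h \<bullet> D')"
      using that unfolding gderiv_def by (rule has_derivative_unique)
    hence "\<forall>h. h \<bullet> D = h \<bullet> D'"
      by (simp add: fun_eq_iff)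
    thus ?thesis
      by (simp only: vector_eq_ldot)
  qed
  show ?thesis
    unfolding gradient_def using ex by (rule theI) (rule uniq[OF _ ex])
qed

definition strongly_convex :: "real \<Rightarrow> ('a::real_inner \<Rightarrow> real) \<Rightarrow> bool" where
  "strongly_convex \<mu> f \<longleftrightarrow>
     (\<forall>u v. f v \<ge> f u + gradient f u \<bullet> (v - u) + \<mu> / 2 * (norm (v - u))\<^sup>2)"

definition undirected_connected :: "('n \<times> 'n) set \<Rightarrow> bool" where
  "undirected_connected E \<longleftrightarrow> sym E \<and> (\<forall>u v. (u, v) \<in> E\<^sup>*)"

definition nbhd :: "('n \<times> 'n) set \<Rightarrow> 'n \<Rightarrow> 'n set" where
  "nbhd E i = {j. (j, i) \<in> E} \<union> {i}"

definition doubly_stochastic :: "real^'n^'n \<Rightarrow> bool" where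
  "doubly_stochastic W \<longleftrightarrow>
     (\<forall>i j. 0 \<le> W $ i $ j) \<and>
     (\<forall>i. (\<Sum>j\<in>UNIV. W $ i $ j) = 1) \<and> (\<forall>j. (\<Sum>i\<in>UNIV. W $ i $ j) = 1)"

text \<open>Trajectories are indexed as \<open>x k i\<close>: iteration first, agent second.\<close>

definition Lf_est :: "('n \<Rightarrow> 'a::real_inner \<Rightarrow> real) \<Rightarrow> (nat \<Rightarrow> 'n \<Rightarrow> 'a) \<Rightarrow> nat \<Rightarrow> 'n \<Rightarrow> real" where
  "Lf_est f x k i =
     norm (gradient (f i) (x (Suc k) i) - gradient (f i) (x k i)) / norm (x (Suc k) i - x k i)"

definition Ly_est :: "(nat \<Rightarrow> 'n \<Rightarrow> 'a::real_inner) \<Rightarrow> (nat \<Rightarrow> 'n \<Rightarrow> 'a) \<Rightarrow> nat \<Rightarrow> 'n \<Rightarrow> real" where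
  "Ly_est x y k i = norm (y (Suc k) i - y k i) / norm (x (Suc k) i - x k i)"

text \<open>A candidate with vanishing curvature estimate is \<open>+\<infinity>\<close>, hence the type \<^typ>\<open>ereal\<close>;
  as the growth candidate is finite, taking the minimum then omits it.\<close>

definition curv_cand :: "real \<Rightarrow> real \<Rightarrow> ereal" where
  "curv_cand \<gamma> L = (if L = 0 then \<infinity> else ereal (1 / (2 * \<gamma> * L)))"

definition growth_cand :: "real \<Rightarrow> real \<Rightarrow> ereal" where
  "growth_cand \<theta> a = ereal (sqrt (1 + \<theta>) * a)"

text \<open>All updates take the arguments \<open>\<gamma>\<close>, \<open>L\<^sub>f\<close>, \<open>L\<^sub>y\<close>, \<open>\<theta>\<close>, \<open>\<alpha>\<close>, so that they share
  one type; two of them ignore an argument.\<close>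

type_synonym stepsize_update = "real \<Rightarrow> real \<Rightarrow> real \<Rightarrow> real \<Rightarrow> real \<Rightarrow> ereal"

definition local_update :: stepsize_update where
  "local_update \<gamma> Lf Ly \<theta> a = min (curv_cand \<gamma> Lf) (growth_cand \<theta> a)"

definition combined_update :: stepsize_update where
  "combined_update \<gamma> Lf Ly \<theta> a =
     Min {curv_cand \<gamma> Lf, curv_cand \<gamma> Ly, growth_cand \<theta> a}"

definition tracking_update :: stepsize_update where
  "tracking_update \<gamma> Lf Ly \<theta> a = min (curv_cand \<gamma> Ly) (growth_cand \<theta> a)"

text \<open>The conjunct \<open>x (Suc 0) i \<noteq> x 0 i\<close> is the convention that the quantities needed at
  \<open>k = 0\<close> are well defined; hence the branch keeping the stepsize is only taken
  for \<open>k \<ge> 1\<close>.\<close>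

definition adgt_run ::
  "('n \<times> 'n) set \<Rightarrow> real^'n^'n \<Rightarrow> ('n \<Rightarrow> 'a::real_inner \<Rightarrow> real) \<Rightarrow> real \<Rightarrow> stepsize_update \<Rightarrow>
   (nat \<Rightarrow> 'n \<Rightarrow> 'a) \<Rightarrow> (nat \<Rightarrow> 'n \<Rightarrow> 'a) \<Rightarrow> (nat \<Rightarrow> 'n \<Rightarrow> real) \<Rightarrow> (nat \<Rightarrow> 'n \<Rightarrow> real) \<Rightarrow> bool" where
  "adgt_run E W f \<gamma> upd x y \<alpha> \<theta> \<longleftrightarrow>
     (\<forall>i. y 0 i = gradient (f i) (x 0 i) \<and> \<alpha> 0 i > 0 \<and> \<theta> 0 i = 0 \<and> x (Suc 0) i \<noteq> x 0 i) \<and>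
     (\<forall>k i.
        x (Suc k) i = (\<Sum>j\<in>nbhd E i. W $ i $ j *\<^sub>R (x k j - \<alpha> k j *\<^sub>R y k j)) \<and>
        y (Suc k) i = (\<Sum>j\<in>nbhd E i. W $ i $ j *\<^sub>R y k j)
                        + gradient (f i) (x (Suc k) i) - gradient (f i) (x k i) \<and>
        ereal (\<alpha> (Suc k) i) =
          (if x (Suc k) i = x k i then ereal (\<alpha> k i)
           else upd \<gamma> (Lf_est f x k i) (Ly_est x y k i) (\<theta> k i) (\<alpha> k i)) \<and>
        \<theta> (Suc k) i = \<alpha> (Suc k) i / \<alpha> k i)"

end

theory Submission
  imports Defs
begin

text \<open>Since the rows of \<open>W\<close> sum to one and \<open>W\<close> vanishes off the neighbourhoods, the mixing
  step changes \<open>y\<^sub>i\<close> by exactly the consensus term \<open>r\<close>; hence the change of the tracker is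
  \<open>g + r\<close>. Expanding \<open>\<parallel>g + r\<parallel>\<^sup>2 - \<parallel>g\<parallel>\<^sup>2 = 2 \<langle>g, r\<rangle> + \<parallel>r\<parallel>\<^sup>2\<close> and dividing by the squared
  displacement of \<open>x\<^sub>i\<close> compares the two curvature estimates.

  A candidate is strictly decreasing in its nonnegative estimate, also at the
  estimate zero, where it is infinite (\<open>curv_cand_le_iff\<close>, \<open>curv_cand_less_iff\<close>). So the sign
  of \<open>2 \<langle>g, r\<rangle> + \<parallel>r\<parallel>\<^sup>2\<close> decides which of the two candidates is smaller, and the claims on
  the minimizing candidate follow. The bound on the change of the tracker says only that a
  stepsize not above the tracking candidate satisfies \<open>2 \<gamma> \<alpha> L\<^sub>y \<le> 1\<close>
  (\<open>le_curv_cand_bound\<close>).\<close>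

lemma Lf_est_nonneg: "Lf_est f x k i \<ge> 0"
  by (simp add: Lf_est_def)

lemma Ly_est_nonneg: "Ly_est x y k i \<ge> 0"
  by (simp add: Ly_est_def)

text \<open>The infinite value at a vanishing estimate extends this from positive to nonnegative estimates:
  the division default \<open>1 / 0 = 0\<close> would put the candidate of a zero estimate at the bottom.\<close>

lemma curv_cand_le_iff:
  assumes "\<gamma> > 0" "L \<ge> 0" "M \<ge> 0"
  shows "curv_cand \<gamma> L \<le> curv_cand \<gamma> M \<longleftrightarrow> M \<le> L"
proof (cases "L = 0 \<or> M = 0")
  case True
  then show ?thesis
    using assms by (auto simp: curv_cand_def)
next
  case False
  with assms have "L > 0" "M > 0" by auto
  with assms show ?thesis
    by (simp add: curv_cand_def field_simps)
qed

lemma curv_cand_less_iff: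
  assumes "\<gamma> > 0" "L \<ge> 0" "M \<ge> 0"
  shows "curv_cand \<gamma> L < curv_cand \<gamma> M \<longleftrightarrow> M < L"
  using curv_cand_le_iff[OF assms(1,3,2)] by (simp add: not_le[symmetric])

lemma le_curv_cand_bound:
  assumes "\<gamma> > 0" "L \<ge> 0" "ereal a \<le> curv_cand \<gamma> L"
  shows "2 * \<gamma> * a * L \<le> 1"
proof (cases "L = 0")
  case False
  with assms have "L > 0" "a \<le> 1 / (2 * \<gamma> * L)"
    by (auto simp: curv_cand_def)
  with assms(1) show ?thesis
    by (simp add: field_simps)
qed simp

lemma tracker_change_bound:
  assumes "\<gamma> > 0" "norm (x (Suc k) i - x k i) > 0" "ereal a \<le> curv_cand \<gamma> (Ly_est x y k i)"
  shows "2 * \<gamma> * a * norm (y (Suc k) i - y k i) \<le> norm (x (Suc k) i - x k i)"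
  using le_curv_cand_bound[OF assms(1) Ly_est_nonneg assms(3)] assms(2)
  by (simp add: Ly_est_def divide_le_eq)

lemma sum_weighted_deviation:
  fixes v :: "'n \<Rightarrow> 'a::real_vector"
  assumes "(\<Sum>j\<in>A. w j) = 1"
  shows "(\<Sum>j\<in>A. w j *\<^sub>R (v j - c)) = (\<Sum>j\<in>A. w j *\<^sub>R v j) - c"
  using assms
  by (simp add: scaleR_diff_right sum_subtractf flip: scaleR_left.sum)

lemma adgt_tracker_increment:
  fixes W :: "real^'n^'n"
  assumes "doubly_stochastic W"
    and W_zero: "\<And>j. j \<notin> nbhd E i \<Longrightarrow> W $ i $ j = 0"
    and "adgt_run E W f \<gamma> upd x y \<alpha> \<theta>"
  shows "y (Suc k) i - y k i =
    (gradient (f i) (x (Suc k) i) - gradient (f i) (x k i)) +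
    (\<Sum>j\<in>UNIV. W $ i $ j *\<^sub>R (y k j - y k i))"
proof -
  have "(\<Sum>j\<in>nbhd E i. W $ i $ j *\<^sub>R y k j) = (\<Sum>j\<in>UNIV. W $ i $ j *\<^sub>R y k j)"
    by (rule sum.mono_neutral_left) (auto simp: W_zero)
  moreover have "y (Suc k) i = (\<Sum>j\<in>nbhd E i. W $ i $ j *\<^sub>R y k j)
      + gradient (f i) (x (Suc k) i) - gradient (f i) (x k i)"
    using assms(3) unfolding adgt_run_def by blast
  moreover have "(\<Sum>j\<in>UNIV. W $ i $ j) = 1"
    using assms(1) unfolding doubly_stochastic_def by blast
  ultimately show ?thesis
    by (simp add: sum_weighted_deviation)
qed

lemma adgt_stepsize:
  assumes "adgt_run E W f \<gamma> upd x y \<alpha> \<theta>" "norm (x (Suc k) i - x k i) > 0"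
  shows "ereal (\<alpha> (Suc k) i) =
    upd \<gamma> (Lf_est f x k i) (Ly_est x y k i) (\<theta> k i) (\<alpha> k i)"
proof -
  have "ereal (\<alpha> (Suc k) i) =
      (if x (Suc k) i = x k i then ereal (\<alpha> k i)
       else upd \<gamma> (Lf_est f x k i) (Ly_est x y k i) (\<theta> k i) (\<alpha> k i))"
    using assms(1) unfolding adgt_run_def by blast
  then show ?thesis using assms(2) by simp
qed

lemma curvature_gap:
  assumes "y (Suc k) i - y k i = (gradient (f i) (x (Suc k) i) - gradient (f i) (x k i)) + r"
  shows "(Ly_est x y k i)\<^sup>2 - (Lf_est f x k i)\<^sup>2 =
    (2 * ((gradient (f i) (x (Suc k) i) - gradient (f i) (x k i)) \<bullet> r) + (norm r)\<^sup>2)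
      / (norm (x (Suc k) i - x k i))\<^sup>2"
  unfolding Ly_est_def Lf_est_def assms power_divide diff_divide_distrib[symmetric]
  by (simp only: power2_norm_eq_inner inner_add_left inner_add_right)
    (simp add: inner_commute)

lemma combined_update_eq:
  "combined_update \<gamma> Lf Ly \<theta> a =
    min (curv_cand \<gamma> Ly) (min (curv_cand \<gamma> Lf) (growth_cand \<theta> a))"
  by (simp add: combined_update_def min.left_commute)

theorem mainTheorem4:
  fixes E :: "('n::finite \<times> 'n) set"
    and W :: "real^'n^'n"
    and f :: "'n \<Rightarrow> real^'p \<Rightarrow> real"
    and L \<mu> :: "'n \<Rightarrow> real"
    and \<gamma> :: real
    and upd :: stepsize_update
    and x y :: "nat \<Rightarrow> 'n \<Rightarrow> real^'p"
    and \<alpha> \<theta> :: "nat \<Rightarrow> 'n \<Rightarrow> real"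
    and i :: 'n and k :: nat
    and g r :: "real^'p"
  assumes graph: "undirected_connected E"
    and W_sym: "transpose W = W"
    and W_stoch: "doubly_stochastic W"
    and W_pos: "\<And>i j. j \<in> nbhd E i \<Longrightarrow> W $ i $ j > 0"
    and W_zero: "\<And>i j. j \<notin> nbhd E i \<Longrightarrow> W $ i $ j = 0"
    and f_diff: "\<And>i z. f i differentiable (at z)"
    and f_smooth: "\<And>i. (L i)-lipschitz_on UNIV (gradient (f i))"
    and mu_pos: "\<And>i. \<mu> i > 0"
    and f_conv: "\<And>i. strongly_convex (\<mu> i) (f i)"
    and gamma_pos: "\<gamma> > 0"
    and upd: "upd \<in> {local_update, combined_update, tracking_update}"
    and run: "adgt_run E W f \<gamma> upd x y \<alpha> \<theta>"
    and moved: "norm (x (Suc k) i - x k i) > 0"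
    and g_def: "g = gradient (f i) (x (Suc k) i) - gradient (f i) (x k i)"
    and r_def: "r = (\<Sum>j\<in>UNIV. W $ i $ j *\<^sub>R (y k j - y k i))"
  shows
    "y (Suc k) i - y k i = g + r \<and>
     (Ly_est x y k i)\<^sup>2 - (Lf_est f x k i)\<^sup>2
       = (2 * (g \<bullet> r) + (norm r)\<^sup>2) / (norm (x (Suc k) i - x k i))\<^sup>2 \<and>
     (curv_cand \<gamma> (Ly_est x y k i) \<le> curv_cand \<gamma> (Lf_est f x k i)
        \<longleftrightarrow> 2 * (g \<bullet> r) + (norm r)\<^sup>2 \<ge> 0) \<and>
     combined_update \<gamma> (Lf_est f x k i) (Ly_est x y k i) (\<theta> k i) (\<alpha> k i)
       \<le> local_update \<gamma> (Lf_est f x k i) (Ly_est x y k i) (\<theta> k i) (\<alpha> k i) \<and>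
     (upd = combined_update \<longrightarrow>
        (2 * (g \<bullet> r) + (norm r)\<^sup>2 \<ge> 0 \<and>
         curv_cand \<gamma> (Ly_est x y k i) \<le> growth_cand (\<theta> k i) (\<alpha> k i)
           \<longrightarrow> ereal (\<alpha> (Suc k) i) = curv_cand \<gamma> (Ly_est x y k i)) \<and>
        (2 * (g \<bullet> r) + (norm r)\<^sup>2 > 0 \<and>
         curv_cand \<gamma> (Ly_est x y k i) < growth_cand (\<theta> k i) (\<alpha> k i)
           \<longrightarrow> ereal (\<alpha> (Suc k) i) = curv_cand \<gamma> (Ly_est x y k i) \<and>
               ereal (\<alpha> (Suc k) i) < curv_cand \<gamma> (Lf_est f x k i) \<and>
               ereal (\<alpha> (Suc k) i) < growth_cand (\<theta> k i) (\<alpha> k i)) \<and>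
        2 * \<gamma> * \<alpha> (Suc k) i * norm (y (Suc k) i - y k i) \<le> norm (x (Suc k) i - x k i)) \<and>
     (upd = tracking_update \<longrightarrow>
        (curv_cand \<gamma> (Ly_est x y k i) \<le> growth_cand (\<theta> k i) (\<alpha> k i)
           \<longrightarrow> ereal (\<alpha> (Suc k) i) = curv_cand \<gamma> (Ly_est x y k i)) \<and>
        2 * \<gamma> * \<alpha> (Suc k) i * norm (y (Suc k) i - y k i) \<le> norm (x (Suc k) i - x k i))"
proof -
  let ?Lf = "Lf_est f x k i" and ?Ly = "Ly_est x y k i"
  let ?s = "2 * (g \<bullet> r) + (norm r)\<^sup>2" and ?d = "norm (x (Suc k) i - x k i)"
  have incr: "y (Suc k) i - y k i = g + r"
    unfolding g_def r_def using W_stoch W_zero run by (rule adgt_tracker_increment)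
  have gap: "?Ly\<^sup>2 - ?Lf\<^sup>2 = ?s / ?d\<^sup>2"
    using incr unfolding g_def by (rule curvature_gap)
  have "?s = (?Ly\<^sup>2 - ?Lf\<^sup>2) * ?d\<^sup>2"
    using gap moved by simp
  then have "?s \<ge> 0 \<longleftrightarrow> ?Lf\<^sup>2 \<le> ?Ly\<^sup>2" "?s > 0 \<longleftrightarrow> ?Lf\<^sup>2 < ?Ly\<^sup>2"
    using moved by (simp_all add: zero_le_mult_iff zero_less_mult_iff)
  then have Ly_ge: "?s \<ge> 0 \<longleftrightarrow> ?Lf \<le> ?Ly" and Ly_gt: "?s > 0 \<longleftrightarrow> ?Lf < ?Ly"
    by (simp_all add: Lf_est_nonneg Ly_est_nonneg power_mono_iff flip: not_le)
  have le_iff: "curv_cand \<gamma> ?Ly \<le> curv_cand \<gamma> ?Lf \<longleftrightarrow> ?s \<ge> 0"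
    unfolding Ly_ge using gamma_pos Ly_est_nonneg Lf_est_nonneg by (rule curv_cand_le_iff)
  have less_iff: "curv_cand \<gamma> ?Ly < curv_cand \<gamma> ?Lf \<longleftrightarrow> ?s > 0"
    unfolding Ly_gt using gamma_pos Ly_est_nonneg Lf_est_nonneg by (rule curv_cand_less_iff)
  have comb_le_local: "combined_update \<gamma> ?Lf ?Ly (\<theta> k i) (\<alpha> k i)
      \<le> local_update \<gamma> ?Lf ?Ly (\<theta> k i) (\<alpha> k i)"
    unfolding combined_update_eq local_update_def by (rule min.cobounded2)
  note step = adgt_stepsize[OF run moved]
  have bound: "2 * \<gamma> * \<alpha> (Suc k) i * norm (y (Suc k) i - y k i) \<le> ?d"
    if "upd = combined_update \<or> upd = tracking_update"
  proof (rule tracker_change_bound[where x = x and y = y, OF gamma_pos moved])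
    show "ereal (\<alpha> (Suc k) i) \<le> curv_cand \<gamma> ?Ly"
      using that unfolding step by (auto simp: combined_update_eq tracking_update_def)
  qed
  have comb_tie: "ereal (\<alpha> (Suc k) i) = curv_cand \<gamma> ?Ly"
    if "upd = combined_update" "?s \<ge> 0"
      "curv_cand \<gamma> ?Ly \<le> growth_cand (\<theta> k i) (\<alpha> k i)"
    using that le_iff unfolding step by (simp add: combined_update_eq min_absorb1)
  have comb_strict: "ereal (\<alpha> (Suc k) i) = curv_cand \<gamma> ?Ly \<and>
      ereal (\<alpha> (Suc k) i) < curv_cand \<gamma> ?Lf \<and>
      ereal (\<alpha> (Suc k) i) < growth_cand (\<theta> k i) (\<alpha> k i)"
    if "upd = combined_update" "?s > 0"
      "curv_cand \<gamma> ?Ly < growth_cand (\<theta> k i) (\<alpha> k i)"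
    using comb_tie that less_iff by simp
  have track_tie: "ereal (\<alpha> (Suc k) i) = curv_cand \<gamma> ?Ly"
    if "upd = tracking_update" "curv_cand \<gamma> ?Ly \<le> growth_cand (\<theta> k i) (\<alpha> k i)"
    using that unfolding step by (simp add: tracking_update_def min_absorb1)
  show ?thesis
    using incr gap le_iff comb_le_local bound comb_tie comb_strict track_tie by blast
qed

end
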